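(* Let $m$ be a positive integer, let $\Omega = \{x_1, x_2, \ldots, x_m\}$ be a set of $m$ (distinct, commuting) variables, and let $u$ be an additional variable. Let $\Pi(\Omega)$ denote the set of all set partitions of $\Omega$. Then the polynomial identity $$\sum_{P \in \Pi(\Omega)} \prod_{T\in P} u\Big(\sum_{x\in T} x \Big)^{|T|-1} = u \Big(u +\sum_{x\in\Omega} x\Big)^{m-1}$$ holds.
   Context: A set partition $P$ of $\Omega$ is an unordered collection of nonempty, pairwise disjoint subsets of $\Omega$ (called parts) whose union is $\Omega$. For a part $T \in P$, $|T|$ denotes its number of elements. The identity is one of polynomials in the commuting variables $u, x_1, \ldots, x_m$; a zeroth power equals $1$. The factor $u$ on the left-hand side lies inside the product over $T \in P$, so each partition $P$ contributes one factor $u$ per part. *)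

theory Defs
  imports "HOL-Library.Poly_Mapping" "HOL-Library.Disjoint_Sets"
begin

datatype indeterminate = U | X nat

text \<open>
  Polynomials in commuting indeterminates with coefficients in \<open>'a\<close>: finitely supported maps
  from monomials to coefficients, a monomial being a finitely supported map from indeterminates
  to exponents. The product is the convolution product of \<^theory>\<open>HOL-Library.Poly_Mapping\<close>.
\<close>
type_synonym 'a mpolynomial = "(indeterminate \<Rightarrow>\<^sub>0 nat) \<Rightarrow>\<^sub>0 'a"

definition var :: "indeterminate \<Rightarrow> 'a::comm_ring_1 mpolynomial" where
  "var v = Poly_Mapping.single (Poly_Mapping.single v 1) 1"

lemma inj_var: "inj (var :: indeterminate \<Rightarrow> 'a::comm_ring_1 mpolynomial)"
proof (rule injI)
  fix v w :: indeterminate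
  assume "(var v :: 'a mpolynomial) = var w"
  then have "Poly_Mapping.lookup (var v :: 'a mpolynomial) (Poly_Mapping.single v 1)
      = Poly_Mapping.lookup (var w) (Poly_Mapping.single v 1)" by simp
  then have eq: "Poly_Mapping.single w (1::nat) = Poly_Mapping.single v 1"
    by (simp add: var_def lookup_single when_def split: if_splits)
  have "Poly_Mapping.lookup (Poly_Mapping.single w (1::nat)) v = 1"
    unfolding eq by simp
  then show "v = w"
    by (simp add: lookup_single when_def split: if_splits)
qed

definition set_partitions :: "'b set \<Rightarrow> 'b set set set" where
  "set_partitions S = {P. partition_on S P}"

end

(*
  Splitting off the part containing a fixed element s of the ground set turns the left-hand side
  into a sum over the union B of the remaining parts, which is evaluated by induction. What is
  left is Hurwitz's form of Abel's identity
    sum over B of x (x + w(B))^(|B| - 1) (y + w(S - B))^|S - B| = (x + y + w(S))^|S|.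
  With z = x + y + w(S) the last factor on the left is (z - (x + w(B)))^(|S| - |B|). Expanding
  in powers of z, the coefficient of z^k for k < |S| is an alternating sum over subsets of a
  polynomial of too small a degree, hence 0.
*)
theory Submission
  imports Defs
begin

lemma sum_Pow_insert:
  fixes f :: "'b set \<Rightarrow> 'a::comm_monoid_add"
  assumes "finite S" "v \<notin> S"
  shows "(\<Sum>B\<in>Pow (insert v S). f B) = (\<Sum>B\<in>Pow S. f B + f (insert v B))"
proof -
  have "inj_on (insert v) (Pow S)"
    using assms(2) by (auto simp: inj_on_def)
  moreover have "Pow S \<inter> insert v ` Pow S = {}"
    using assms(2) by auto
  ultimately show ?thesis
    using assms(1) by (simp add: Pow_insert sum.union_disjoint sum.reindex sum.distrib)
qed

text \<open>The binomial coefficient counts the \<open>k\<close>-subsets of \<open>S - B\<close>, so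
  in the 0/1 indicators of the elements of \<open>B\<close> it has degree at most \<open>k\<close>,
  and the power has degree at most \<open>d\<close>. The signed sum over all subsets kills every
  polynomial of degree below \<open>card S\<close>. The induction realises this by pairing
  \<open>B\<close> with \<open>insert v B\<close>, a discrete difference in direction
  \<open>v\<close>.\<close>

lemma alternating_sum_Pow_power_eq_0:
  fixes w :: "'b \<Rightarrow> 'a::comm_ring_1"
  assumes "finite S" "d + k < card S"
  shows "(\<Sum>B\<in>Pow S. (-1) ^ card B * of_nat ((card S - card B) choose k) * (x + sum w B) ^ d) = 0"
  using assms
proof (induction S arbitrary: d k rule: finite_induct)
  case empty
  then show ?case by simp
next
  case (insert v S)
  define c where "c = (\<lambda>k (B :: 'b set). (-1) ^ card B * of_nat ((card S - card B) choose k) :: 'a)"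
  define g where "g = (\<lambda>B. x + sum w B)"
  define p where "p = (if k = 0 then (\<lambda>B. 0) else c (k - 1))"
  have IH: "(\<Sum>B\<in>Pow S. c k B * g B ^ d) = 0" if "d + k < card S" for d k
    using insert.IH[OF that] by (simp add: c_def g_def)
  \<comment> \<open>Passing from \<open>insert v B\<close> to \<open>B\<close> raises the upper
    index of the binomial by one, so Pascal's rule yields \<open>p B\<close>; in the remaining
    difference the top term \<open>c k B * g B ^ d\<close> cancels. What survives has
    \<open>(d, k - 1)\<close> or \<open>(j, k)\<close> with \<open>j < d\<close>, so the degree
    bound drops by one together with the ground set.\<close>
  have step: "(-1) ^ card B * of_nat ((card (insert v S) - card B) choose k) * g B ^ d
      + (-1) ^ card (insert v B) * of_nat ((card (insert v S) - card (insert v B)) choose k)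
          * g (insert v B) ^ d
      = p B * g B ^ d - (\<Sum>j<d. of_nat (d choose j) * w v ^ (d - j) * (c k B * g B ^ j))"
    if "B \<in> Pow S" for B
  proof -
    have B: "finite B" "v \<notin> B" "card B \<le> card S"
      using that insert.hyps by (auto intro: finite_subset card_mono)
    have "g (insert v B) ^ d = (g B + w v) ^ d"
      using B by (simp add: g_def algebra_simps)
    also have "\<dots> = (\<Sum>j\<le>d. of_nat (d choose j) * g B ^ j * w v ^ (d - j))"
      by (rule binomial_ring)
    also have "\<dots> = (\<Sum>j<d. of_nat (d choose j) * g B ^ j * w v ^ (d - j)) + g B ^ d"
      by (simp add: lessThan_Suc_atMost[symmetric])
    finally have g: "c k B * g (insert v B) ^ d
        = (\<Sum>j<d. of_nat (d choose j) * w v ^ (d - j) * (c k B * g B ^ j)) + c k B * g B ^ d"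
      by (simp add: distrib_left sum_distrib_left mult_ac)
    have "(-1) ^ card B * of_nat ((card (insert v S) - card B) choose k) = c k B + p B"
      using B insert.hyps
      by (cases k) (simp_all add: c_def p_def Suc_diff_le distrib_left)
    moreover have "(-1) ^ card (insert v B)
        * of_nat ((card (insert v S) - card (insert v B)) choose k) = - c k B"
      using B insert.hyps by (simp add: c_def)
    ultimately show ?thesis
      using g by (simp add: distrib_right)
  qed
  have "(\<Sum>B\<in>Pow S. p B * g B ^ d) = 0"
    using IH[of d "k - 1"] insert by (simp add: p_def)
  moreover have "(\<Sum>B\<in>Pow S. \<Sum>j<d. of_nat (d choose j) * w v ^ (d - j) * (c k B * g B ^ j)) = 0"
    using IH insert.prems insert.hyps
    by (subst sum.swap) (simp add: sum_distrib_left[symmetric])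
  moreover have "(\<Sum>B\<in>Pow (insert v S). (-1) ^ card B
        * of_nat ((card (insert v S) - card B) choose k) * g B ^ d)
      = (\<Sum>B\<in>Pow S. p B * g B ^ d
          - (\<Sum>j<d. of_nat (d choose j) * w v ^ (d - j) * (c k B * g B ^ j)))"
    unfolding sum_Pow_insert[OF insert.hyps] by (rule sum.cong[OF refl step])
  ultimately show ?case
    by (simp only: sum_subtractf g_def diff_self)
qed

text \<open>The case distinction stands for \<open>x * x ^ (-1) = 1\<close> at \<open>B = {}\<close>.\<close>
definition abel_weight :: "('b \<Rightarrow> 'a::comm_ring_1) \<Rightarrow> 'a \<Rightarrow> 'b set \<Rightarrow> 'a" where
  "abel_weight w x B = (if B = {} then 1 else x * (x + sum w B) ^ (card B - 1))"

lemma hurwitz_identity: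
  fixes w :: "'b \<Rightarrow> 'a::comm_ring_1"
  assumes "finite S"
  shows "(\<Sum>B\<in>Pow S. abel_weight w x B * (y + sum w (S - B)) ^ card (S - B))
    = (x + y + sum w S) ^ card S"
proof -
  define n where "n = card S"
  define z where "z = x + y + sum w S"
  define g where "g = (\<lambda>B. x + sum w B)"
  define t where "t = (\<lambda>k B. of_nat ((n - card B) choose k) * (-1) ^ (n - card B - k)
      * (abel_weight w x B * g B ^ (n - card B - k)))"
  have expand: "abel_weight w x B * (y + sum w (S - B)) ^ card (S - B) = (\<Sum>k\<le>n. z ^ k * t k B)"
    if "B \<in> Pow S" for B
  proof -
    have B: "finite B" "B \<subseteq> S"
      using that assms by (auto intro: finite_subset)
    then have "y + sum w (S - B) = z + - g B"
      using assms by (simp add: z_def g_def sum_diff)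
    moreover have "card (S - B) = n - card B"
      using B by (simp add: n_def card_Diff_subset)
    ultimately have "(y + sum w (S - B)) ^ card (S - B)
        = (\<Sum>k\<le>n - card B. of_nat ((n - card B) choose k) * z ^ k * (- g B) ^ (n - card B - k))"
      by (simp only: binomial_ring)
    \<comment> \<open>A range of \<open>k\<close> that does not depend on \<open>B\<close> allows
      the two sums to be swapped later.\<close>
    also have "\<dots> = (\<Sum>k\<le>n. of_nat ((n - card B) choose k) * z ^ k * (- g B) ^ (n - card B - k))"
      by (intro sum.mono_neutral_left) (auto simp: binomial_eq_0)
    finally show ?thesis
      by (simp add: t_def sum_distrib_left mult_ac power_minus[of "g B"])
  qed
  have low: "(\<Sum>B\<in>Pow S. t k B) = 0" if "k < n" for k
  proof -
    have "t k B = (-1) ^ (n - k) * x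
        * ((-1) ^ card B * of_nat ((card S - card B) choose k) * (x + sum w B) ^ (n - k - 1))"
      if "B \<in> Pow S" for B
    proof (cases "k \<le> n - card B")
      case True
      have "card B \<le> n"
        using that assms by (auto simp: n_def intro: card_mono)
      have "finite B"
        using that assms by (auto intro: finite_subset)
      \<comment> \<open>The exponents \<open>card B - 1\<close> and \<open>n - card B - k\<close>
        add up to a value independent of \<open>B\<close>, so the vanishing lemma applies with
        \<open>d = n - k - 1\<close>. For \<open>B = {}\<close> the weight is 1 and the factor
        \<open>x\<close> is taken from \<open>g {} ^ (n - k)\<close>, which is where
        \<open>k < n\<close> enters.\<close>
      have weight: "abel_weight w x B * g B ^ (n - card B - k) = x * g B ^ (n - k - 1)"
      proof (cases "B = {}")
        case True
        then show ?thesis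
          using \<open>k < n\<close> by (simp add: abel_weight_def g_def power_Suc[symmetric] Suc_diff_Suc
            del: power_Suc)
      next
        case False
        then have "card B > 0"
          using \<open>finite B\<close> by (simp add: card_gt_0_iff)
        then have "card B - 1 + (n - card B - k) = n - k - 1"
          using True \<open>card B \<le> n\<close> \<open>k < n\<close> by linarith
        then show ?thesis
          using False by (simp add: abel_weight_def g_def mult.assoc flip: power_add)
      qed
      have sign: "(-1 :: 'a) ^ (n - card B - k) = (-1) ^ (n - k) * (-1) ^ card B"
      proof -
        have "n - k = (n - card B - k) + card B"
          using True \<open>card B \<le> n\<close> \<open>k < n\<close> by linarith
        then have "(-1 :: 'a) ^ (n - k) = (-1) ^ (n - card B - k) * (-1) ^ card B"
          by (metis power_add)
        then show ?thesis
          by (simp add: mult.assoc)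
      qed
      show ?thesis
        unfolding t_def weight sign by (simp add: g_def n_def mult_ac)
    next
      case False
      then show ?thesis by (simp add: t_def n_def binomial_eq_0)
    qed
    moreover have "n - k - 1 + k < card S"
      using that by (simp add: n_def)
    ultimately show ?thesis
      using alternating_sum_Pow_power_eq_0[OF assms, of "n - k - 1" k x w]
      by (simp add: sum_distrib_left[symmetric])
  qed
  \<comment> \<open>For \<open>k = n\<close> the binomial leaves only the empty set.\<close>
  have "t n B = (if B = {} then 1 else 0)" if "B \<in> Pow S" for B
  proof (cases "B = {}")
    case False
    then have "card B > 0" "card B \<le> n"
      using that assms by (auto simp: card_gt_0_iff n_def intro: finite_subset card_mono)
    then show ?thesis using False by (simp add: t_def binomial_eq_0)
  qed (simp add: t_def abel_weight_def)
  then have top: "(\<Sum>B\<in>Pow S. t n B) = 1"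
    using assms by simp
  have "(\<Sum>B\<in>Pow S. abel_weight w x B * (y + sum w (S - B)) ^ card (S - B))
      = (\<Sum>k\<le>n. z ^ k * (\<Sum>B\<in>Pow S. t k B))"
    by (simp only: expand sum_distrib_left cong: sum.cong) (rule sum.swap)
  also have "\<dots> = z ^ n"
    using low top by (simp add: lessThan_Suc_atMost[symmetric])
  finally show ?thesis
    by (simp add: z_def n_def)
qed

text \<open>A partition corresponds to a pair \<open>(B, Q)\<close>: \<open>B\<close> is the union
  of the parts avoiding \<open>s\<close>, and \<open>Q\<close> consists of these parts. Indexing by
  \<open>B\<close> instead of by the part of \<open>s\<close> gives the shape of
  \<open>hurwitz_identity\<close>.\<close>

lemma sum_prod_set_partitions_insert:
  fixes f :: "'b set \<Rightarrow> 'a::comm_semiring_1"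
  assumes "finite S" "s \<notin> S"
  shows "(\<Sum>P\<in>set_partitions (insert s S). \<Prod>T\<in>P. f T)
    = (\<Sum>B\<in>Pow S. f (insert s (S - B)) * (\<Sum>Q\<in>set_partitions B. \<Prod>T\<in>Q. f T))"
proof -
  have fin: "finite (set_partitions B)" if "B \<in> Pow S" for B
    using that assms(1) finitely_many_partition_on[of B]
    by (auto simp: set_partitions_def intro: finite_subset)
  \<comment> \<open>The part of \<open>s\<close> is not yet in \<open>Q\<close>, so the product over
    the enlarged partition splits off exactly one factor.\<close>
  have finQ: "finite Q" and new: "insert s (S - B) \<notin> Q"
    if "B \<in> Pow S" "Q \<in> set_partitions B" for B Q
    using that assms finite_elements[of B Q]
    by (auto simp: set_partitions_def partition_on_def intro: finite_subset)
  have "(\<Sum>B\<in>Pow S. f (insert s (S - B)) * (\<Sum>Q\<in>set_partitions B. \<Prod>T\<in>Q. f T))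
      = (\<Sum>B\<in>Pow S. \<Sum>Q\<in>set_partitions B. \<Prod>T\<in>insert (insert s (S - B)) Q. f T)"
    using finQ new by (simp add: sum_distrib_left)
  also have "\<dots> = (\<Sum>(B, Q)\<in>Sigma (Pow S) set_partitions. \<Prod>T\<in>insert (insert s (S - B)) Q. f T)"
    using assms(1) fin by (subst sum.Sigma) auto
  also have "\<dots> = (\<Sum>P\<in>set_partitions (insert s S). \<Prod>T\<in>P. f T)"
  proof (rule sum.reindex_bij_witness[where
        j = "\<lambda>(B, Q). insert (insert s (S - B)) Q" and
        i = "\<lambda>P. let T = (THE T. T \<in> P \<and> s \<in> T) in (insert s S - T, P - {T})"])
    fix a assume a: "a \<in> Sigma (Pow S) set_partitions"
    obtain B Q where BQ: "a = (B, Q)" "B \<subseteq> S" "partition_on B Q"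
      using a by (auto simp: set_partitions_def)
    have "(THE T. T \<in> insert (insert s (S - B)) Q \<and> s \<in> T) = insert s (S - B)"
      using BQ assms(2) by (intro the_equality) (auto simp: partition_on_def)
    moreover have "insert s S - insert s (S - B) = B"
      using BQ(2) assms(2) by auto
    moreover have "insert s (S - B) \<notin> Q"
      using BQ new by (auto simp: set_partitions_def)
    ultimately show "(let T = (THE T. T \<in> (case a of (B, Q) \<Rightarrow> insert (insert s (S - B)) Q) \<and> s \<in> T)
      in (insert s S - T, (case a of (B, Q) \<Rightarrow> insert (insert s (S - B)) Q) - {T})) = a"
      using BQ(1) by (simp add: Let_def)
    have "disjnt (insert s (S - B)) (\<Union>Q)"
      using BQ assms(2) by (auto simp: partition_on_def disjnt_def)
    moreover have "insert s S - insert s (S - B) = B"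
      using BQ(2) assms(2) by auto
    ultimately show "(case a of (B, Q) \<Rightarrow> insert (insert s (S - B)) Q) \<in> set_partitions (insert s S)"
      using BQ by (auto simp: set_partitions_def partition_on_insert)
  next
    fix P assume "P \<in> set_partitions (insert s S)"
    then have P: "partition_on (insert s S) P"
      by (simp add: set_partitions_def)
    then obtain T where T: "T \<in> P" "s \<in> T"
      by (auto simp: partition_on_def)
    then have the: "(THE T. T \<in> P \<and> s \<in> T) = T"
      using disjointD[OF partition_onD2[OF P]] by (intro the_equality) blast+
    have sub: "T \<subseteq> insert s S"
      using P T by (auto simp: partition_on_def)
    have eq: "insert s (S - (insert s S - T)) = T"
      using sub T(2) by auto
    show "(case let T = (THE T. T \<in> P \<and> s \<in> T) in (insert s S - T, P - {T})
        of (B, Q) \<Rightarrow> insert (insert s (S - B)) Q) = P"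
      using eq T(1) by (auto simp: the Let_def)
    have "disjnt T (\<Union>(P - {T}))"
      using disjointD[OF partition_onD2[OF P] T(1)] by (fastforce simp: disjnt_def)
    then have "partition_on (insert s S - T) (P - {T})"
      using P partition_on_insert[of T "P - {T}" "insert s S"] T(1) by (simp add: insert_absorb)
    then show "(let T = (THE T. T \<in> P \<and> s \<in> T) in (insert s S - T, P - {T}))
        \<in> Sigma (Pow S) set_partitions"
      using T(2) by (auto simp: the Let_def set_partitions_def)
  qed auto
  finally show ?thesis by simp
qed

text \<open>Strong induction is needed because the parts avoiding \<open>s\<close> may cover any
  subset of \<open>R\<close>, always a proper subset of \<open>S\<close>. The empty ground set has
  one partition, with empty product 1, in agreement with \<open>abel_weight\<close>.\<close>

lemma sum_set_partitions_eq_abel_weight: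
  fixes w :: "'b \<Rightarrow> 'a::comm_ring_1"
  assumes "finite S"
  shows "(\<Sum>P\<in>set_partitions S. \<Prod>T\<in>P. u * (\<Sum>x\<in>T. w x) ^ (card T - 1)) = abel_weight w u S"
  using assms
proof (induction S rule: finite_psubset_induct)
  case (psubset S)
  show ?case
  proof (cases "S = {}")
    case True
    then show ?thesis
      by (simp add: set_partitions_def partition_on_empty abel_weight_def)
  next
    case False
    then obtain s R where S: "S = insert s R" "s \<notin> R"
      by (meson Set.set_insert ex_in_conv)
    then have R: "finite R"
      using psubset.hyps by simp
    have "(\<Sum>P\<in>set_partitions S. \<Prod>T\<in>P. u * (\<Sum>x\<in>T. w x) ^ (card T - 1))
        = (\<Sum>B\<in>Pow R. u * sum w (insert s (R - B)) ^ (card (insert s (R - B)) - 1)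
            * abel_weight w u B)"
      unfolding S(1) sum_prod_set_partitions_insert[OF R S(2)]
      using S by (intro sum.cong refl arg_cong2[where f = "(*)"] psubset.IH) auto
    \<comment> \<open>The part of \<open>s\<close> has \<open>card (R - B) + 1\<close> elements, so
      its exponent becomes \<open>card (R - B)\<close>.\<close>
    also have "\<dots> = u * (\<Sum>B\<in>Pow R. abel_weight w u B * (w s + sum w (R - B)) ^ card (R - B))"
      using R S(2) by (simp add: sum_distrib_left mult_ac)
    \<comment> \<open>Hurwitz's identity for \<open>R\<close> with \<open>x = u\<close> and
      \<open>y = w s\<close>; the exponent \<open>card R\<close> is
      \<open>card S - 1\<close>.\<close>
    also have "\<dots> = abel_weight w u S"
      using R S by (subst hurwitz_identity) (simp_all add: abel_weight_def add.assoc)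
    finally show ?thesis .
  qed
qed

theorem theorem1:
  fixes m :: nat and u :: "'a::comm_ring_1 mpolynomial" and \<Omega> :: "'a mpolynomial set"
  assumes "m \<ge> 1"
  defines "u \<equiv> var U"
  defines "\<Omega> \<equiv> (\<lambda>i. var (X i)) ` {1..m}"
  shows "(\<Sum>P\<in>set_partitions \<Omega>. \<Prod>T\<in>P. u * (\<Sum>x\<in>T. x) ^ (card T - 1))
       = u * (u + (\<Sum>x\<in>\<Omega>. x)) ^ (m - 1)"
proof -
  \<comment> \<open>Distinct indices give distinct polynomials, so the image has exactly
    \<open>m\<close> elements and the exponent is \<open>m - 1\<close>.\<close>
  have "inj_on (\<lambda>i. var (X i) :: 'a mpolynomial) {1..m}"
    by (auto intro!: inj_onI dest: injD[OF inj_var])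
  then have "card \<Omega> = m"
    by (simp add: \<Omega>_def card_image)
  moreover have "finite \<Omega>" "\<Omega> \<noteq> {}"
    using assms(1) by (auto simp: \<Omega>_def)
  \<comment> \<open>The ground set consists of the variables themselves, so the weight function is
    the identity.\<close>
  ultimately show ?thesis
    using sum_set_partitions_eq_abel_weight[of \<Omega> u "\<lambda>x. x"] by (simp add: abel_weight_def)
qed

end
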